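(* Let $\mu$ and $\nu$ be two positive real numbers with $\mu<\nu$. Then the following inequalities hold: (1) $\left|A^{-1}(\mu,\nu)-L^{-1}(\mu,\nu)\right|\leq\dfrac{(\nu-\mu)^2}{48}\left[\max\left\{\dfrac{2}{\mu^3},\dfrac{16}{(\mu+\nu)^3}\right\}+\max\left\{\dfrac{2}{\nu^3},\dfrac{16}{(\mu+\nu)^3}\right\}\right]$; (2) $\left|\dfrac{2A^{-1}(\mu,\nu)+H^{-1}(\mu,\nu)}{3}-L^{-1}(\mu,\nu)\right|\leq\dfrac{(\nu-\mu)^2}{162}\left[\max\left\{\dfrac{2}{\mu^3},\dfrac{16}{(\mu+\nu)^3}\right\}+\max\left\{\dfrac{2}{\nu^3},\dfrac{16}{(\mu+\nu)^3}\right\}\right]$; (3) $\left|\dfrac{A^{-1}(\mu,\nu)+H^{-1}(\mu,\nu)}{2}-L^{-1}(\mu,\nu)\right|\leq\dfrac{(\nu-\mu)^2}{96}\left[\max\left\{\dfrac{2}{\mu^3},\dfrac{16}{(\mu+\nu)^3}\right\}+\max\left\{\dfrac{2}{\nu^3},\dfrac{16}{(\mu+\nu)^3}\right\}\right]$; (4) $\left|H^{-1}(\mu,\nu)-L^{-1}(\mu,\nu)\right|\leq\dfrac{(\nu-\mu)^2}{24}\left[\max\left\{\dfrac{2}{\mu^3},\dfrac{16}{(\mu+\nu)^3}\right\}+\max\left\{\dfrac{2}{\nu^3},\dfrac{16}{(\mu+\nu)^3}\right\}\right]$.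
   Context: For positive numbers $\mu\neq\nu$: the arithmetic mean is $A(\mu,\nu)=\frac{\mu+\nu}{2}$, the harmonic mean is $H(\mu,\nu)=\frac{2\mu\nu}{\mu+\nu}$, and the logarithmic mean is $L(\mu,\nu)=\frac{\nu-\mu}{\ln\nu-\ln\mu}$. The notation $A^{-1}(\mu,\nu)$ means the reciprocal $1/A(\mu,\nu)$, and similarly for $H^{-1}$ and $L^{-1}$. *)

theory Defs
  imports Complex_Main
begin

definition arithmetic_mean :: "real \<Rightarrow> real \<Rightarrow> real" where
  "arithmetic_mean \<mu> \<nu> = (\<mu> + \<nu>) / 2"

definition harmonic_mean :: "real \<Rightarrow> real \<Rightarrow> real" where
  "harmonic_mean \<mu> \<nu> = 2 * \<mu> * \<nu> / (\<mu> + \<nu>)"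

(* Meaningful for distinct positive arguments only; on the diagonal the quotient is 0 / 0 = 0,
   not the usual continuous extension. *)
definition logarithmic_mean :: "real \<Rightarrow> real \<Rightarrow> real" where
  "logarithmic_mean \<mu> \<nu> = (\<nu> - \<mu>) / (ln \<nu> - ln \<mu>)"

end

theory Submission
  imports Defs
begin

text \<open>
  Write \<open>\<mu> = c (1 - t)\<close> and \<open>\<nu> = c (1 + t)\<close> with \<open>c > 0\<close> and \<open>0 < t < 1\<close>. After multiplication
  by \<open>c\<close> the three reciprocal means depend on \<open>t\<close> alone:
  \<open>A\<inverse>\<close> becomes \<open>1\<close>, \<open>H\<inverse>\<close> becomes \<open>w = 1 / (1 - t\<^sup>2)\<close> and \<open>L\<inverse>\<close> becomes \<open>a = artanh t / t\<close>.
  The right-hand sides become \<open>8 t\<^sup>2 (u\<^sup>3 + 1) / k\<close> with \<open>u = 1 / (1 - t)\<close> and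
  \<open>k = 48, 162, 96, 24\<close>, because \<open>\<mu>\<close> is below and \<open>\<nu>\<close> above the midpoint \<open>c\<close>, which
  decides both maxima.

  The power series of \<open>a\<close> is \<open>1 + t\<^sup>2/3 + t\<^sup>4/5 + \<dots>\<close>, so replacing its later coefficients by \<open>0\<close>
  or by \<open>1/3\<close> gives \<open>1 + t\<^sup>2/3 \<le> a \<le> (2 + w) / 3\<close> (\<open>artanh_lower\<close>, \<open>artanh_upper\<close>). The
  upper bound is the Simpson-like combination occurring in the second inequality, so the two bounds
  settle the sign of all four differences: \<open>1 \<le> a \<le> (2 + w) / 3 \<le> (1 + w) / 2 \<le> w\<close>.
  Since \<open>w = 1 + t\<^sup>2 w\<close>, inserting the upper bound for \<open>a\<close> in the first difference and the lower
  bound in the others leaves, after division by \<open>t\<^sup>2\<close>, inequalities between \<open>w = u\<^sup>2 / (2 u - 1)\<close> and \<open>u\<^sup>3\<close>. They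
  follow from two polynomial inequalities in \<open>u - 1 \<ge> 0\<close> (\<open>harmonic_le_cube\<close>,
  \<open>harmonic_excess_le_cube\<close>).
\<close>

text \<open>
  Both sides vanish at \<open>0\<close>, and the derivatives compare as \<open>1 + x\<^sup>2 \<le> 1 / (1 - x\<^sup>2)\<close>.
\<close>

lemma artanh_lower:
  fixes t :: real
  assumes "0 \<le> t" "t < 1"
  shows "t + t ^ 3 / 3 \<le> artanh t"
proof -
  let ?f = "\<lambda>x::real. artanh x - (x + x ^ 3 / 3)"
  have "?f 0 \<le> ?f t"
  proof (rule DERIV_nonneg_imp_nondecreasing[where f = ?f])
    fix x :: real
    assume x: "0 \<le> x" "x \<le> t"
    then have "\<bar>x\<bar> < 1" using assms by simp
    then have sq: "x\<^sup>2 < 1" by (simp add: abs_square_less_1)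
    have "(?f has_real_derivative 1 / (1 - x\<^sup>2) - (1 + x\<^sup>2)) (at x)"
      using \<open>\<bar>x\<bar> < 1\<close> by (auto intro!: derivative_eq_intros simp: power2_eq_square)
    moreover have "(1 + x\<^sup>2) * (1 - x\<^sup>2) \<le> 1" by (simp add: algebra_simps)
    then have "0 \<le> 1 / (1 - x\<^sup>2) - (1 + x\<^sup>2)" using sq by (simp add: field_simps)
    ultimately show "\<exists>y. (?f has_real_derivative y) (at x) \<and> 0 \<le> y" by blast
  qed (use assms in auto)
  then show ?thesis by simp
qed

text \<open>
  Both sides vanish at \<open>0\<close>, and the derivative of the difference is
  \<open>2 x\<^sup>4 / (3 (1 - x\<^sup>2)\<^sup>2) \<ge> 0\<close>.
\<close>

lemma artanh_upper:
  fixes t :: real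
  assumes "0 \<le> t" "t < 1"
  shows "artanh t \<le> t + t ^ 3 / (3 * (1 - t\<^sup>2))"
proof -
  let ?f = "\<lambda>x::real. x + x ^ 3 / (3 * (1 - x\<^sup>2)) - artanh x"
  have "?f 0 \<le> ?f t"
  proof (rule DERIV_nonneg_imp_nondecreasing[where f = ?f])
    fix x :: real
    assume x: "0 \<le> x" "x \<le> t"
    then have "\<bar>x\<bar> < 1" using assms by simp
    then have sq: "x\<^sup>2 < 1" by (simp add: abs_square_less_1)
    let ?D = "1 + (3 * x\<^sup>2 * (3 * (1 - x\<^sup>2)) + x ^ 3 * (6 * x)) / (3 * (1 - x\<^sup>2))\<^sup>2
                - 1 / (1 - x\<^sup>2)"
    have "(?f has_real_derivative ?D) (at x)"
      using \<open>\<bar>x\<bar> < 1\<close> sq by (auto intro!: derivative_eq_intros simp: power2_eq_square)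
    moreover have "?D = 2 * x ^ 4 / (3 * (1 - x\<^sup>2)\<^sup>2)"
    proof -
      define d where "d = 1 - x\<^sup>2"
      have "d \<noteq> 0" and eq: "x\<^sup>2 = 1 - d" using sq by (auto simp: d_def)
      have "x ^ 3 * (6 * x) = 6 * (1 - d)\<^sup>2" "x ^ 4 = (1 - d)\<^sup>2"
        by (simp_all add: eq[symmetric] power2_eq_square numeral_eq_Suc)
      with \<open>d \<noteq> 0\<close> show ?thesis
        unfolding d_def[symmetric] eq by (simp add: field_simps power2_eq_square)
    qed
    then have "0 \<le> ?D" by simp
    ultimately show "\<exists>y. (?f has_real_derivative y) (at x) \<and> 0 \<le> y" by blast
  qed (use assms in auto)
  then show ?thesis by simp
qed

text \<open>
  The parameter \<open>s\<close> ranges over \<open>s \<ge> 0\<close> and makes both \<open>1 / (1 - t) = 1 + s\<close> and \<open>1 / (1 - t\<^sup>2)\<close>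
  rational with a positive denominator, so that estimates between them become polynomial ones.
\<close>

lemma inverse_one_minus_square_eq:
  fixes s t :: real
  assumes "0 \<le> t" "t < 1" "s = t / (1 - t)"
  shows "1 / (1 - t\<^sup>2) = (1 + s)\<^sup>2 / (1 + 2 * s)"
proof -
  have u: "1 + s = 1 / (1 - t)" and v: "1 + 2 * s = (1 + t) / (1 - t)"
    using assms by (simp_all add: field_simps)
  have "1 - t\<^sup>2 = (1 - t) * (1 + t)" by (simp add: algebra_simps power2_eq_square)
  with assms show ?thesis unfolding u v by (simp add: power2_eq_square)
qed

text \<open>
  With \<open>u = 1 / (1 - t)\<close> and \<open>s = u - 1\<close> one has \<open>1 / (1 - t\<^sup>2) = u\<^sup>2 / (2 u - 1)\<close>, and after clearing
  the denominator the difference of the two sides is \<open>s (2 s\<^sup>3 + 7 s\<^sup>2 + 3 s + 3)\<close>.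
\<close>

lemma harmonic_le_cube:
  fixes t :: real
  assumes "0 \<le> t" "t < 1"
  shows "6 * (1 / (1 - t\<^sup>2)) \<le> 5 + (1 / (1 - t)) ^ 3"
proof -
  define s where "s = t / (1 - t)"
  have s: "s \<ge> 0" using assms by (simp add: s_def)
  have u: "1 / (1 - t) = 1 + s" using assms by (simp add: s_def field_simps)
  have w: "1 / (1 - t\<^sup>2) = (1 + s)\<^sup>2 / (1 + 2 * s)"
    using assms s_def by (rule inverse_one_minus_square_eq)
  have "0 \<le> s * (2 * s ^ 3 + 7 * s\<^sup>2 + 3 * s + 3)" using s by simp
  also have "\<dots> = (5 + (1 + s) ^ 3) * (1 + 2 * s) - 6 * (1 + s)\<^sup>2"
    by (simp add: algebra_simps power2_eq_square power3_eq_cube)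
  finally show ?thesis unfolding u w using s by (simp add: pos_divide_le_eq)
qed

text \<open>
  With \<open>s = t / (1 - t)\<close> as in \<open>harmonic_le_cube\<close>, clearing the denominator \<open>1 + 2 s\<close> leaves the
  nonnegative difference \<open>8 s\<^sup>4 + 28 s\<^sup>3 + 9 s\<^sup>2 + 28 s + 8\<close>.
\<close>

lemma harmonic_excess_le_cube:
  fixes t :: real
  assumes "0 \<le> t" "t < 1"
  shows "27 * (1 / (1 - t\<^sup>2) - 1) \<le> 4 * (1 + (1 / (1 - t)) ^ 3)"
proof -
  define s where "s = t / (1 - t)"
  have s: "s \<ge> 0" using assms by (simp add: s_def)
  have u: "1 / (1 - t) = 1 + s" using assms by (simp add: s_def field_simps)
  have w: "1 / (1 - t\<^sup>2) = (1 + s)\<^sup>2 / (1 + 2 * s)"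
    using assms s_def by (rule inverse_one_minus_square_eq)
  have "0 \<le> 8 * s ^ 4 + 28 * s ^ 3 + 9 * s\<^sup>2 + 28 * s + 8" using s by simp
  also have "\<dots> = (4 * (1 + (1 + s) ^ 3) + 27) * (1 + 2 * s) - 27 * (1 + s)\<^sup>2"
    by (simp add: algebra_simps numeral_eq_Suc)
  finally have "27 * ((1 + s)\<^sup>2 / (1 + 2 * s)) \<le> 4 * (1 + (1 + s) ^ 3) + 27"
    using s by (simp add: pos_divide_le_eq)
  then show ?thesis unfolding u w by simp
qed

text \<open>
  After division by \<open>t\<^sup>2\<close> the bounds for \<open>artanh\<close> show that the four absolute differences are at most \<open>w / 3\<close>, \<open>(w - 1) / 3\<close>, \<open>w / 2 - 1 / 3\<close>
  and \<open>w - 1 / 3\<close>. The third bound is the most demanding one: it needs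
  \<open>6 w \<le> 4 + B\<close>, which together with \<open>B \<ge> 2\<close> also gives the first and the last.
\<close>

lemma scaled_mean_bounds:
  fixes t :: real
  assumes "0 < t" "t < 1"
  defines "a \<equiv> artanh t / t" and "w \<equiv> 1 / (1 - t\<^sup>2)" and "B \<equiv> (1 / (1 - t)) ^ 3 + 1"
  shows "\<bar>1 - a\<bar> \<le> 8 * t\<^sup>2 / 48 * B"
    and "\<bar>(2 + w) / 3 - a\<bar> \<le> 8 * t\<^sup>2 / 162 * B"
    and "\<bar>(1 + w) / 2 - a\<bar> \<le> 8 * t\<^sup>2 / 96 * B"
    and "\<bar>w - a\<bar> \<le> 8 * t\<^sup>2 / 24 * B"
proof -
  have sq: "t\<^sup>2 < 1" using assms by (simp add: abs_square_less_1)
  have w: "w = 1 + t\<^sup>2 * w" using sq by (simp add: w_def field_simps)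
  have lower: "1 + t\<^sup>2 / 3 \<le> a"
    using artanh_lower[of t] assms(1,2)
    by (simp add: a_def field_simps power2_eq_square power3_eq_cube)
  have "a \<le> (t + t ^ 3 / (3 * (1 - t\<^sup>2))) / t"
    unfolding a_def using artanh_upper[of t] assms(1,2) by (intro divide_right_mono) auto
  also have "\<dots> = 1 + t\<^sup>2 * w / 3"
    using assms(1) by (simp add: w_def add_divide_distrib power2_eq_square power3_eq_cube)
  finally have upper: "a \<le> 1 + t\<^sup>2 * w / 3" .
  have tw: "0 \<le> t\<^sup>2 * w" using sq by (simp add: w_def)
  have B1: "6 * w \<le> 4 + B" and B2: "w - 1 \<le> 4 * B / 27"
    using harmonic_le_cube[of t] harmonic_excess_le_cube[of t] assms(1,2)
    by (simp_all add: w_def B_def)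
  have "1 \<le> (1 / (1 - t)) ^ 3" using assms(1,2) by (intro one_le_power) simp
  then have B3: "2 \<le> B" by (simp add: B_def)
  have scale: "t\<^sup>2 * x \<le> t\<^sup>2 * y" if "x \<le> y" for x y
    using that by (rule mult_left_mono) simp
  have "t\<^sup>2 * w \<le> t\<^sup>2 * (B / 2)" by (rule scale) (use B1 B3 in linarith)
  moreover have "1 \<le> a" using lower zero_le_power2[of t] by linarith
  ultimately show "\<bar>1 - a\<bar> \<le> 8 * t\<^sup>2 / 48 * B"
    using upper by simp
  have "t\<^sup>2 * (w - 1) \<le> t\<^sup>2 * (4 * B / 27)" using B2 by (rule scale)
  with lower upper w show "\<bar>(2 + w) / 3 - a\<bar> \<le> 8 * t\<^sup>2 / 162 * B"
    by (simp add: abs_le_iff algebra_simps)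
  have "t\<^sup>2 * (6 * w) \<le> t\<^sup>2 * (4 + B)" by (rule scale) (use B1 in linarith)
  with lower upper w tw show "\<bar>(1 + w) / 2 - a\<bar> \<le> 8 * t\<^sup>2 / 96 * B"
    by (simp add: abs_le_iff algebra_simps)
  have "t\<^sup>2 * (3 * w) \<le> t\<^sup>2 * (1 + B)" by (rule scale) (use B1 B3 in linarith)
  with lower upper w tw show "\<bar>w - a\<bar> \<le> 8 * t\<^sup>2 / 24 * B"
    by (simp add: abs_le_iff algebra_simps)
qed

lemma inverse_logarithmic_mean_eq_artanh:
  fixes c t :: real
  assumes "0 < c" "0 < t" "t < 1"
  shows "inverse (logarithmic_mean (c * (1 - t)) (c * (1 + t))) = (artanh t / t) / c"
proof -
  have "ln (c * (1 + t)) - ln (c * (1 - t)) = 2 * artanh t"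
    using assms by (simp add: artanh_def ln_mult ln_div)
  moreover have "c * (1 + t) - c * (1 - t) = 2 * (c * t)" by (simp add: algebra_simps)
  ultimately show ?thesis by (simp add: logarithmic_mean_def)
qed

theorem proposition15:
  fixes \<mu> \<nu> :: real
  assumes "0 < \<mu>" and "0 < \<nu>" and "\<mu> < \<nu>"
  shows "\<bar>inverse (arithmetic_mean \<mu> \<nu>)
             - inverse (logarithmic_mean \<mu> \<nu>)\<bar>
           \<le> (\<nu> - \<mu>)\<^sup>2 / 48 * (max (2 / \<mu> ^ 3) (16 / (\<mu> + \<nu>) ^ 3)
                          + max (2 / \<nu> ^ 3) (16 / (\<mu> + \<nu>) ^ 3))
       \<and> \<bar>(2 * inverse (arithmetic_mean \<mu> \<nu>) + inverse (harmonic_mean \<mu> \<nu>)) / 3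
             - inverse (logarithmic_mean \<mu> \<nu>)\<bar>
           \<le> (\<nu> - \<mu>)\<^sup>2 / 162 * (max (2 / \<mu> ^ 3) (16 / (\<mu> + \<nu>) ^ 3)
                          + max (2 / \<nu> ^ 3) (16 / (\<mu> + \<nu>) ^ 3))
       \<and> \<bar>(inverse (arithmetic_mean \<mu> \<nu>) + inverse (harmonic_mean \<mu> \<nu>)) / 2
             - inverse (logarithmic_mean \<mu> \<nu>)\<bar>
           \<le> (\<nu> - \<mu>)\<^sup>2 / 96 * (max (2 / \<mu> ^ 3) (16 / (\<mu> + \<nu>) ^ 3)
                          + max (2 / \<nu> ^ 3) (16 / (\<mu> + \<nu>) ^ 3))
       \<and> \<bar>inverse (harmonic_mean \<mu> \<nu>)
             - inverse (logarithmic_mean \<mu> \<nu>)\<bar>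
           \<le> (\<nu> - \<mu>)\<^sup>2 / 24 * (max (2 / \<mu> ^ 3) (16 / (\<mu> + \<nu>) ^ 3)
                          + max (2 / \<nu> ^ 3) (16 / (\<mu> + \<nu>) ^ 3))"
proof -
  define c where "c = (\<mu> + \<nu>) / 2"
  define t where "t = (\<nu> - \<mu>) / (\<mu> + \<nu>)"
  define a where "a = artanh t / t"
  define w where "w = 1 / (1 - t\<^sup>2)"
  define B where "B = (1 / (1 - t)) ^ 3 + 1"
  have c: "0 < c" and t: "0 < t" "t < 1" using assms by (simp_all add: c_def t_def)
  have "c * t = (\<nu> - \<mu>) / 2" using assms by (simp add: c_def t_def field_simps)
  then have mu: "\<mu> = c * (1 - t)" and nu: "\<nu> = c * (1 + t)"
    by (simp_all add: c_def algebra_simps) (simp_all add: field_simps)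
  have A: "inverse (arithmetic_mean \<mu> \<nu>) = 1 / c"
    by (simp add: arithmetic_mean_def c_def field_simps)
  have H: "inverse (harmonic_mean \<mu> \<nu>) = w / c"
  proof -
    have "\<mu> + \<nu> = 2 * c" by (simp add: c_def)
    moreover have "\<mu> * \<nu> = c * (c * (1 - t\<^sup>2))"
      by (simp add: mu nu algebra_simps power2_eq_square)
    ultimately have "harmonic_mean \<mu> \<nu> = c * (1 - t\<^sup>2)"
      using c by (simp add: harmonic_mean_def mult.assoc)
    then show ?thesis by (simp add: w_def field_simps)
  qed
  have L: "inverse (logarithmic_mean \<mu> \<nu>) = a / c"
    unfolding mu nu a_def using c t by (rule inverse_logarithmic_mean_eq_artanh)
  have mid: "16 / (\<mu> + \<nu>) ^ 3 = 2 / c ^ 3"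
    by (simp add: c_def power_divide)
  have "2 / c ^ 3 \<le> 2 / \<mu> ^ 3"
    using assms by (intro divide_left_mono power_mono mult_pos_pos zero_less_power) (auto simp: c_def)
  moreover have "2 / \<nu> ^ 3 \<le> 2 / c ^ 3"
    using assms by (intro divide_left_mono power_mono mult_pos_pos zero_less_power) (auto simp: c_def)
  moreover have "2 / \<mu> ^ 3 + 2 / c ^ 3 = 2 / c ^ 3 * B"
    by (simp add: B_def mu power_mult_distrib power_divide distrib_left)
  ultimately have bracket:
    "max (2 / \<mu> ^ 3) (16 / (\<mu> + \<nu>) ^ 3) + max (2 / \<nu> ^ 3) (16 / (\<mu> + \<nu>) ^ 3) = 2 / c ^ 3 * B"
    unfolding mid by simp
  have "\<nu> - \<mu> = 2 * c * t" by (simp add: mu nu algebra_simps)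
  then have rhs: "(\<nu> - \<mu>)\<^sup>2 / k * (2 / c ^ 3 * B) = 8 * t\<^sup>2 / k * B / c" for k
    using c by (simp add: power_mult_distrib power2_eq_square power3_eq_cube)
  have scale: "\<bar>x / c - a / c\<bar> \<le> y / c" if "\<bar>x - a\<bar> \<le> y" for x y
    using that c by (simp add: diff_divide_distrib[symmetric] divide_right_mono)
  have means: "(2 * (1 / c) + w / c) / 3 = ((2 + w) / 3) / c"
      "(1 / c + w / c) / 2 = ((1 + w) / 2) / c"
    by (simp_all add: add_divide_distrib)
  show ?thesis
    unfolding A H L bracket rhs means
    using scaled_mean_bounds[OF t, folded a_def w_def B_def] by (blast intro: scale)
qed

end
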